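(* Let $L$ be an SPS lattice (a finite slim, planar, semimodular lattice, with a fixed planar diagram) and let $\mathfrak p$ and $\mathfrak q$ be distinct prime intervals in $L$. Then $\mathfrak q$ is collapsed by $\operatorname{con}(\mathfrak p)$ if and only if there exist a prime interval $\mathfrak r$ and a sequence of pairwise distinct prime intervals $\mathfrak r = \mathfrak r_0, \mathfrak r_1, \dots, \mathfrak r_n = \mathfrak q$ of $L$ such that $\mathfrak p$ is up-perspective to $\mathfrak r$, and $\mathfrak r_i$ is down-perspective to or swings to $\mathfrak r_{i+1}$ for $i = 0, \dots, n-1$. In addition, such a sequence also satisfies $$1_{\mathfrak r_0} \geq 1_{\mathfrak r_1} \geq \dots \geq 1_{\mathfrak r_n}.$$
   Context: A prime interval is an interval $\mathfrak p = [0_{\mathfrak p}, 1_{\mathfrak p}]$ with $0_{\mathfrak p} \prec 1_{\mathfrak p}$ (i.e. $1_{\mathfrak p}$ covers $0_{\mathfrak p}$). $\operatorname{con}(\mathfrak p)$ is the smallest congruence of $L$ identifying $0_{\mathfrak p}$ and $1_{\mathfrak p}$. A congruence collapses an interval $[a,b]$ if it identifies $a$ and $b$. Perspectivity: $[a,b]$ is up-perspective to $[c,d]$ if $a = b \wedge c$ and $d = b \vee c$; $[a,b]$ is down-perspective to $[c,d]$ if $b = a \vee d$ and $c = a \wedge d$. An SPS lattice is a finite lattice that is planar (it has a planar Hasse diagram; one such diagram is fixed, so that the lower covers of any element are ordered from left to right), semimodular (upper semimodular), and slim. A planar semimodular lattice is slim if it contains no sublattice isomorphic to $\mathsf M_3$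 (the five-element modular nondistributive lattice). For prime intervals $\mathfrak p, \mathfrak q$ of an SPS lattice, $\mathfrak p$ swings to $\mathfrak q$ if $1_{\mathfrak p} = 1_{\mathfrak q}$, this element covers at least three elements, and $0_{\mathfrak q}$ is neither the left-most nor the right-most element covered by $1_{\mathfrak p} = 1_{\mathfrak q}$. *)

theory Defs
  imports "HOL-Analysis.Line_Segment"
begin

definition covered_by :: "'a::order \<Rightarrow> 'a \<Rightarrow> bool" where
  "covered_by a b \<longleftrightarrow> a < b \<and> (\<nexists>z. a < z \<and> z < b)"

definition lower_covers :: "'a::order \<Rightarrow> 'a set" where
  "lower_covers u = {a. covered_by a u}"

text \<open>An interval \<open>[a, b]\<close> is encoded as the pair \<open>(a, b)\<close> of its endpoints.\<close>

definition prime_interval :: "'a::order \<times> 'a \<Rightarrow> bool" where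
  "prime_interval p \<longleftrightarrow> covered_by (fst p) (snd p)"

definition up_perspective :: "'a::lattice \<times> 'a \<Rightarrow> 'a \<times> 'a \<Rightarrow> bool" where
  "up_perspective I J \<longleftrightarrow> fst I = inf (snd I) (fst J) \<and> snd J = sup (snd I) (fst J)"

definition down_perspective :: "'a::lattice \<times> 'a \<Rightarrow> 'a \<times> 'a \<Rightarrow> bool" where
  "down_perspective I J \<longleftrightarrow> snd I = sup (fst I) (snd J) \<and> fst J = inf (fst I) (snd J)"

definition congruence :: "('a::lattice \<times> 'a) set \<Rightarrow> bool" where
  "congruence \<theta> \<longleftrightarrow> equiv UNIV \<theta> \<and>
     (\<forall>a b c d. (a, b) \<in> \<theta> \<longrightarrow> (c, d) \<in> \<theta> \<longrightarrow>
        (inf a c, inf b d) \<in> \<theta> \<and> (sup a c, sup b d) \<in> \<theta>)"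

definition collapses :: "('a \<times> 'a) set \<Rightarrow> 'a \<times> 'a \<Rightarrow> bool" where
  "collapses \<theta> I \<longleftrightarrow> (fst I, snd I) \<in> \<theta>"

definition con :: "'a::lattice \<times> 'a \<Rightarrow> ('a \<times> 'a) set" where
  "con I = \<Inter>{\<theta>. congruence \<theta> \<and> collapses \<theta> I}"

lemma congruence_con: "congruence (con I)"
proof -
  let ?C = "{\<theta>. congruence \<theta> \<and> collapses \<theta> I}"
  have eqv: "equiv UNIV \<theta>" if "\<theta> \<in> ?C" for \<theta>
    using that by (simp add: congruence_def)
  have "equiv UNIV (\<Inter>?C)"
  proof (rule equivI)
    show "refl (\<Inter>?C)"
      using eqv by (meson InterI UNIV_I equivE refl_on_def)
    show "sym (\<Inter>?C)"
      using eqv by (meson InterD InterI equivE symD symI)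
    show "trans (\<Inter>?C)"
      using eqv by (meson InterD InterI equivE transD transI)
  qed simp
  moreover have "(inf a c, inf b d) \<in> \<Inter>?C \<and> (sup a c, sup b d) \<in> \<Inter>?C"
    if "(a, b) \<in> \<Inter>?C" "(c, d) \<in> \<Inter>?C" for a b c d
    using that by (simp add: congruence_def)
  ultimately show ?thesis
    unfolding con_def congruence_def [of "\<Inter>?C"] by blast
qed

lemma collapses_con: "collapses (con I) I"
  by (simp add: con_def collapses_def)

lemma con_least: "congruence \<theta> \<Longrightarrow> collapses \<theta> I \<Longrightarrow> con I \<subseteq> \<theta>"
  by (auto simp: con_def)

datatype m3 = M3_Bot | M3_A | M3_B | M3_C | M3_Top

instantiation m3 :: lattice
begin

definition less_eq_m3 :: "m3 \<Rightarrow> m3 \<Rightarrow> bool" where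
  "less_eq_m3 x y \<longleftrightarrow> x = y \<or> x = M3_Bot \<or> y = M3_Top"

definition less_m3 :: "m3 \<Rightarrow> m3 \<Rightarrow> bool" where
  "less_m3 x y \<longleftrightarrow> x \<le> y \<and> x \<noteq> y"

definition inf_m3 :: "m3 \<Rightarrow> m3 \<Rightarrow> m3" where
  "inf_m3 x y = (if x \<le> y then x else if y \<le> x then y else M3_Bot)"

definition sup_m3 :: "m3 \<Rightarrow> m3 \<Rightarrow> m3" where
  "sup_m3 x y = (if x \<le> y then y else if y \<le> x then x else M3_Top)"

instance
proof
  fix x y z :: m3
  show "x < y \<longleftrightarrow> x \<le> y \<and> \<not> y \<le> x"
    by (cases x; cases y) (simp_all add: less_m3_def less_eq_m3_def)
  show "x \<le> x"
    by (simp add: less_eq_m3_def)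
  show "x \<le> z" if "x \<le> y" "y \<le> z"
    using that by (cases x; cases y; cases z) (simp_all add: less_eq_m3_def)
  show "x = y" if "x \<le> y" "y \<le> x"
    using that by (cases x; cases y) (simp_all add: less_eq_m3_def)
  show "inf x y \<le> x" "inf x y \<le> y" "x \<le> sup x y" "y \<le> sup x y"
    by (cases x; cases y; simp add: less_eq_m3_def inf_m3_def sup_m3_def)+
  show "x \<le> inf y z" if "x \<le> y" "x \<le> z"
    using that by (cases x; cases y; cases z) (simp_all add: less_eq_m3_def inf_m3_def)
  show "sup y z \<le> x" if "y \<le> x" "z \<le> x"
    using that by (cases x; cases y; cases z) (simp_all add: less_eq_m3_def sup_m3_def)
qed

end

definition lattice_embedding :: "('a::lattice \<Rightarrow> 'b::lattice) \<Rightarrow> bool" where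
  "lattice_embedding f \<longleftrightarrow> inj f \<and>
     (\<forall>x y. f (inf x y) = inf (f x) (f y) \<and> f (sup x y) = sup (f x) (f y))"

text \<open>A planar Hasse diagram places the elements at points of the plane (first coordinate
  to the right, second coordinate upwards) and draws every covering pair as a straight
  segment; two distinct edges meet only in a common endpoint.\<close>

definition planar_diagram :: "('a::order \<Rightarrow> real \<times> real) \<Rightarrow> bool" where
  "planar_diagram pos \<longleftrightarrow>
     inj pos \<and>
     (\<forall>a b. a < b \<longrightarrow> snd (pos a) < snd (pos b)) \<and>
     (\<forall>a b z. covered_by a b \<longrightarrow> pos z \<in> closed_segment (pos a) (pos b) \<longrightarrow> z \<in> {a, b}) \<and>
     (\<forall>a b c d. covered_by a b \<longrightarrow> covered_by c d \<longrightarrow> (a, b) \<noteq> (c, d) \<longrightarrow>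
        closed_segment (pos a) (pos b) \<inter> closed_segment (pos c) (pos d)
          \<subseteq> pos ` ({a, b} \<inter> {c, d}))"

text \<open>Lower covers \<open>a\<close> and \<open>b\<close> of \<open>u\<close> may be drawn at different heights, so the
  left-to-right order compares the edges leaving \<open>u\<close> downwards, by their horizontal
  displacement per unit of descent, and not the abscissae of \<open>a\<close> and \<open>b\<close>.\<close>

definition edge_run :: "('a \<Rightarrow> real \<times> real) \<Rightarrow> 'a \<Rightarrow> 'a \<Rightarrow> real" where
  "edge_run pos u a = (fst (pos a) - fst (pos u)) / (snd (pos u) - snd (pos a))"

definition leftmost_lower_cover :: "('a::order \<Rightarrow> real \<times> real) \<Rightarrow> 'a \<Rightarrow> 'a \<Rightarrow> bool" where
  "leftmost_lower_cover pos u a \<longleftrightarrow> a \<in> lower_covers u \<and>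
     (\<forall>b \<in> lower_covers u - {a}. edge_run pos u a < edge_run pos u b)"

definition rightmost_lower_cover :: "('a::order \<Rightarrow> real \<times> real) \<Rightarrow> 'a \<Rightarrow> 'a \<Rightarrow> bool" where
  "rightmost_lower_cover pos u a \<longleftrightarrow> a \<in> lower_covers u \<and>
     (\<forall>b \<in> lower_covers u - {a}. edge_run pos u b < edge_run pos u a)"

text \<open>A sublattice isomorphic to \<open>M\<^sub>3\<close> is the image of a lattice embedding of \<^typ>\<open>m3\<close>.\<close>

locale sps_lattice =
  fixes pos :: "'a::{finite, lattice} \<Rightarrow> real \<times> real"
  assumes planar: "planar_diagram pos"
    and semimodular: "\<And>a b c :: 'a. covered_by a b \<Longrightarrow>
          sup a c = sup b c \<or> covered_by (sup a c) (sup b c)"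
    and slim: "\<nexists>f :: m3 \<Rightarrow> 'a. lattice_embedding f"

definition swings :: "('a::order \<Rightarrow> real \<times> real) \<Rightarrow> 'a \<times> 'a \<Rightarrow> 'a \<times> 'a \<Rightarrow> bool" where
  "swings pos p q \<longleftrightarrow> prime_interval p \<and> prime_interval q \<and> snd p = snd q \<and>
     card (lower_covers (snd q)) \<ge> 3 \<and>
     \<not> leftmost_lower_cover pos (snd q) (fst q) \<and>
     \<not> rightmost_lower_cover pos (snd q) (fst q)"

text \<open>Only the values \<open>r 0, \<dots>, r n\<close> are relevant.\<close>

definition swing_sequence ::
  "('a::lattice \<Rightarrow> real \<times> real) \<Rightarrow> 'a \<times> 'a \<Rightarrow> 'a \<times> 'a \<Rightarrow> nat \<Rightarrow> (nat \<Rightarrow> 'a \<times> 'a) \<Rightarrow> bool" where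
  "swing_sequence pos p q n r \<longleftrightarrow>
     (\<forall>i\<le>n. prime_interval (r i)) \<and> inj_on r {0..n} \<and>
     up_perspective p (r 0) \<and> r n = q \<and>
     (\<forall>i<n. down_perspective (r i) (r (Suc i)) \<or> swings pos (r i) (r (Suc i)))"

end

theory Submission
  imports Defs
begin

text \<open>Call a prime interval reachable from \<open>p\<close> if it ends a sequence that begins with an
  up-perspectivity from \<open>p\<close> and continues with down-perspectivities and swings. The proof shows
  that the reachable prime intervals generate, as links of a zigzag, a congruence that collapses
  no further prime interval; since it collapses \<open>p\<close>, it contains \<open>con p\<close>.

  The diagram enters through three facts, all of which say that a chain cannot leave a region
  bounded by two other chains without passing through a vertex of their boundary. If \<open>a\<close>, \<open>b\<close>,
  \<open>c\<close> are covers of \<open>x\<close> from left to right, then \<open>b \<le> sup a c\<close>; in a semimodular lattice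
  \<open>x, a, b, c, sup a c\<close> then form an \<open>M\<^sub>3\<close>, so slimness leaves at most two upper covers
  to every element. Dually, if \<open>a\<close>, \<open>b\<close>, \<open>c\<close> are lower covers of \<open>u\<close> from left to right, then
  \<open>inf a c \<le> b\<close>, which is why a congruence identifying \<open>a\<close> or \<open>c\<close> with \<open>u\<close> also identifies
  \<open>b\<close> with \<open>u\<close>: swings are sound. Finally, such a middle lower cover \<open>b\<close> has \<open>u\<close> as its only
  upper cover. The first fact is lemma \<open>middle_upper_cover_le_sup\<close>, the second
  \<open>inf_le_middle_lower_cover\<close>, the third \<open>middle_lower_cover_unique_cover\<close>.

  Compatibility with joins amounts to closure of the reachable intervals under
  up-perspectivity, one cover at a time (\<open>reach_up_cover\<close>). An interval just reached by a
  down-perspectivity can only be pushed up along that same perspectivity, because its bottom has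
  no third upper cover; an interval just reached by a swing cannot be pushed up at all, because its
  bottom has a single upper cover.

  Compatibility with meets says that if \<open>[a, u]\<close> is reachable and \<open>b \<le> u\<close>, then \<open>inf a b\<close> and
  \<open>b\<close> are joined by a chain of reachable intervals (\<open>reach_meet\<close>). The bottom link of this chain is
  down-perspective from \<open>[a, u]\<close>. A higher link \<open>[c, x]\<close> is pushed up as far as possible towards
  \<open>a\<close>, to \<open>[m, d]\<close>; the part of the chain below it, which is already known to be reachable, is pushed up
  to give a reachable \<open>[a', d]\<close>, which swings to \<open>[m, d]\<close>, and \<open>[c, x]\<close> is down-perspective
  from there (\<open>reach_meet_step\<close>).\<close>

section \<open>Covers in a finite order\<close>

lemma cover_above_below:
  fixes a b :: "'a::{finite, order}"
  assumes "a < b"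
  obtains c where "covered_by a c" "c \<le> b"
proof -
  have "finite {z. a < z \<and> z \<le> b}" "b \<in> {z. a < z \<and> z \<le> b}"
    using assms by auto
  then obtain c where c: "c \<in> {z. a < z \<and> z \<le> b}"
      "\<forall>z \<in> {z. a < z \<and> z \<le> b}. z \<le> c \<longrightarrow> c = z"
    using finite_has_minimal2 by blast
  then have "covered_by a c"
    unfolding covered_by_def by (auto dest: order_less_imp_le order_trans)
  then show ?thesis
    using c(1) that by auto
qed

lemma cover_below_above:
  fixes a b :: "'a::{finite, order}"
  assumes "a < b"
  obtains c where "covered_by c b" "a \<le> c"
proof -
  have "finite {z. a \<le> z \<and> z < b}" "a \<in> {z. a \<le> z \<and> z < b}"
    using assms by auto
  then obtain c where c: "c \<in> {z. a \<le> z \<and> z < b}"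
      "\<forall>z \<in> {z. a \<le> z \<and> z < b}. c \<le> z \<longrightarrow> c = z"
    using finite_has_maximal2 by blast
  then have "covered_by c b"
    unfolding covered_by_def by (auto dest: order_less_imp_le order_trans)
  then show ?thesis
    using c(1) that by auto
qed

lemma cover_induct_down [consumes 1, case_names top cover]:
  fixes a w :: "'a::{finite, order}"
  assumes "a \<le> w" and top: "P w"
    and step: "\<And>x c. covered_by x c \<Longrightarrow> c \<le> w \<Longrightarrow> P c \<Longrightarrow> P x"
  shows "P a"
  using \<open>a \<le> w\<close>
proof (induction "card {a..w}" arbitrary: a rule: less_induct)
  case less
  show ?case
  proof (cases "a = w")
    case True
    then show ?thesis using top by simp
  next
    case False
    with less.prems obtain c where c: "covered_by a c" "c \<le> w"
      using cover_above_below[of a w] by force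
    then have "a < c"
      by (simp add: covered_by_def)
    then have "{c..w} \<subset> {a..w}"
      using less.prems by (auto dest: less_le_trans less_imp_le)
    then have "card {c..w} < card {a..w}"
      by (simp add: psubset_card_mono)
    then show ?thesis
      using less.hyps c step by blast
  qed
qed

lemma cover_induct_up [consumes 1, case_names bottom cover]:
  fixes a w :: "'a::{finite, order}"
  assumes "w \<le> a" and bottom: "P w"
    and step: "\<And>c x. covered_by c x \<Longrightarrow> w \<le> c \<Longrightarrow> P c \<Longrightarrow> P x"
  shows "P a"
  using \<open>w \<le> a\<close>
proof (induction "card {w..a}" arbitrary: a rule: less_induct)
  case less
  show ?case
  proof (cases "a = w")
    case True
    then show ?thesis using bottom by simp
  next
    case False
    with less.prems obtain c where c: "covered_by c a" "w \<le> c"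
      using cover_below_above[of w a] by force
    then have "c < a"
      by (simp add: covered_by_def)
    then have "{w..c} \<subset> {w..a}"
      using less.prems by (auto dest: le_less_trans less_imp_le)
    then have "card {w..c} < card {w..a}"
      by (simp add: psubset_card_mono)
    then show ?thesis
      using less.hyps c step by blast
  qed
qed

lemma covered_by_less: "covered_by a b \<Longrightarrow> a < b"
  by (simp add: covered_by_def)

lemma covered_by_between:
  "covered_by a b \<Longrightarrow> a \<le> z \<Longrightarrow> z \<le> b \<Longrightarrow> z = a \<or> z = b"
  by (auto simp: covered_by_def order_le_less)

lemma covered_by_not_le:
  "covered_by a b \<Longrightarrow> covered_by a c \<Longrightarrow> b \<noteq> c \<Longrightarrow> \<not> b \<le> c"
  by (auto simp: covered_by_def order_le_less)

lemma covered_by_not_le':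
  "covered_by a c \<Longrightarrow> covered_by b c \<Longrightarrow> a \<noteq> b \<Longrightarrow> \<not> a \<le> b"
  by (auto simp: covered_by_def order_le_less)

lemma inf_covers:
  fixes a b x :: "'a::lattice"
  assumes "covered_by x a" "covered_by x b" "a \<noteq> b"
  shows "inf a b = x"
proof -
  have "inf a b \<noteq> a"
    using covered_by_not_le[OF assms] by (simp add: le_iff_inf)
  moreover have "x \<le> inf a b"
    using assms(1,2) by (simp add: covered_by_def less_imp_le)
  ultimately show ?thesis
    using covered_by_between[OF assms(1) _ inf_le1] by blast
qed

section \<open>Curves of chains in a planar diagram\<close>

locale planar_lattice =
  fixes pos :: "'a::{finite, lattice} \<Rightarrow> real \<times> real"
  assumes planar: "planar_diagram pos"
begin

definition abscissa :: "'a \<Rightarrow> real" where "abscissa a = fst (pos a)"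
definition height :: "'a \<Rightarrow> real" where "height a = snd (pos a)"

lemma pos_eq: "pos a = (abscissa a, height a)"
  by (simp add: abscissa_def height_def)

lemma height_strict: "a < b \<Longrightarrow> height a < height b"
  using planar by (simp add: planar_diagram_def height_def)

lemma height_mono: "a \<le> b \<Longrightarrow> height a \<le> height b"
  using height_strict[of a b] by (auto simp: order_le_less)

lemma height_cover: "covered_by a b \<Longrightarrow> height a < height b"
  by (simp add: height_strict covered_by_less)

text \<open>Degenerate links let a chain with a single element be a curve as well.\<close>

definition link :: "'a \<Rightarrow> 'a \<Rightarrow> bool" where
  "link c d \<longleftrightarrow> c = d \<or> covered_by c d"

text \<open>A chain is drawn as the graph of a function of the height, because every edge of the diagram
  is strictly monotone in the second coordinate. The set \<open>V\<close> records the vertices whose links carry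
  the graph; it is all that is needed to turn a crossing of two curves into a common element of
  two intervals.\<close>

definition curve :: "'a set \<Rightarrow> (real \<Rightarrow> real) \<Rightarrow> real \<Rightarrow> real \<Rightarrow> bool" where
  "curve V f s t \<longleftrightarrow> continuous_on {s..t} f \<and>
     (\<forall>y\<in>{s..t}. \<exists>c\<in>V. \<exists>d\<in>V. link c d \<and> (f y, y) \<in> closed_segment (pos c) (pos d))"

lemma curve_sub: "curve V f s t \<Longrightarrow> s \<le> s' \<Longrightarrow> t' \<le> t \<Longrightarrow> curve V f s' t'"
  unfolding curve_def by (auto intro: continuous_on_subset)

lemma curve_join:
  assumes "curve V f s m" "curve W g m t" "f m = g m"
  shows "curve (V \<union> W) (\<lambda>y. if y \<le> m then f y else g y) s t"
  unfolding curve_def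
proof
  show "continuous_on {s..t} (\<lambda>y. if y \<le> m then f y else g y)"
    using assms unfolding curve_def
    by (intro continuous_on_cases_le) (auto intro: continuous_on_subset continuous_intros)
  show "\<forall>y\<in>{s..t}. \<exists>c\<in>V \<union> W. \<exists>d\<in>V \<union> W. link c d \<and>
      (if y \<le> m then f y else g y, y) \<in> closed_segment (pos c) (pos d)"
  proof
    fix y assume y: "y \<in> {s..t}"
    show "\<exists>c\<in>V \<union> W. \<exists>d\<in>V \<union> W. link c d \<and>
      (if y \<le> m then f y else g y, y) \<in> closed_segment (pos c) (pos d)"
    proof (cases "y \<le> m")
      case True
      then have "y \<in> {s..m}" using y by auto
      then show ?thesis using assms(1) True unfolding curve_def by fastforce
    next
      case False
      then have "y \<in> {m..t}" using y by auto
      then show ?thesis using assms(2) False unfolding curve_def by fastforce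
    qed
  qed
qed

lemma link_heights:
  assumes "link c d" "(x, y) \<in> closed_segment (pos c) (pos d)"
  shows "height c \<le> y" "y \<le> height d"
proof -
  obtain u where u: "0 \<le> u" "u \<le> 1" "(x, y) = (1 - u) *\<^sub>R pos c + u *\<^sub>R pos d"
    using assms(2) unfolding closed_segment_def by auto
  then have y: "y = (1 - u) * height c + u * height d"
    by (simp add: pos_eq)
  have le: "height c \<le> height d"
    using assms(1) height_cover[of c d] unfolding link_def by auto
  have "y = height c + u * (height d - height c)" "y = height d - (1 - u) * (height d - height c)"
    using y by (simp_all add: algebra_simps)
  moreover have "0 \<le> u * (height d - height c)" "0 \<le> (1 - u) * (height d - height c)"
    using u le by simp_all
  ultimately show "height c \<le> y" "y \<le> height d"
    by linarith+
qed

text \<open>By planarity two curves can only cross in a common vertex or run along a common edge. A common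
  edge has one end above and one end below the crossing; the two conclusions keep both, because
  chains are followed upwards in some arguments and downwards in others.\<close>

lemma curves_meet:
  assumes "curve V f s t" "curve W g s' t'" "y \<in> {s..t}" "y \<in> {s'..t'}" "f y = g y"
  shows "\<exists>z \<in> V \<inter> W. y \<le> height z" "\<exists>z \<in> V \<inter> W. height z \<le> y"
proof -
  obtain c d where cd: "c \<in> V" "d \<in> V" "link c d" "(f y, y) \<in> closed_segment (pos c) (pos d)"
    using assms(1,3) unfolding curve_def by blast
  obtain c' d' where cd': "c' \<in> W" "d' \<in> W" "link c' d'"
      "(f y, y) \<in> closed_segment (pos c') (pos d')"
    using assms(2,4,5) unfolding curve_def by metis
  have "(c, d) = (c', d') \<or> (\<exists>z \<in> {c, d} \<inter> {c', d'}. pos z = (f y, y))"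
  proof (cases "covered_by c d \<and> covered_by c' d'")
    case True
    then show ?thesis
      using planar cd(4) cd'(4) unfolding planar_diagram_def by (smt (verit) IntI imageE subsetD)
  next
    case False
    have vertex: "z \<in> {a, b}" if "link a b" "pos z \<in> closed_segment (pos a) (pos b)" for a b z
      using that planar unfolding planar_diagram_def link_def inj_def by fastforce
    consider "c = d" | "c' = d'"
      using False cd(3) cd'(3) link_def by auto
    then show ?thesis
    proof cases
      case 1
      then have "pos c = (f y, y)" using cd(4) by simp
      then show ?thesis using vertex[OF cd'(3), of c] cd'(4) by auto
    next
      case 2
      then have "pos c' = (f y, y)" using cd'(4) by simp
      then show ?thesis using vertex[OF cd(3), of c'] cd(4) by auto
    qed
  qed
  then have "(\<exists>z \<in> V \<inter> W. y \<le> height z) \<and> (\<exists>z \<in> V \<inter> W. height z \<le> y)"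
  proof
    assume "(c, d) = (c', d')"
    then show ?thesis using cd cd' link_heights[OF cd(3,4)] by auto
  next
    assume "\<exists>z \<in> {c, d} \<inter> {c', d'}. pos z = (f y, y)"
    then obtain z where "z \<in> V \<inter> W" "height z = y"
      using cd cd' by (auto simp: height_def)
    then show ?thesis by auto
  qed
  then show "\<exists>z \<in> V \<inter> W. y \<le> height z" "\<exists>z \<in> V \<inter> W. height z \<le> y"
    by blast+
qed

lemma no_meeting_sides:
  fixes f g :: "real \<Rightarrow> real"
  assumes "continuous_on {s..t} f" "continuous_on {s..t} g"
    and "\<And>y. s \<le> y \<Longrightarrow> y \<le> t \<Longrightarrow> f y \<noteq> g y" and "s \<le> t"
  shows "f s < g s \<longleftrightarrow> f t < g t"
proof -
  have c: "continuous_on {s..t} (\<lambda>y. g y - f y)"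
    using assms by (intro continuous_intros)
  show ?thesis
    using IVT'[OF _ _ \<open>s \<le> t\<close> c, of 0] IVT2'[OF _ _ \<open>s \<le> t\<close> c, of 0] assms(3,4)
    by (smt (verit, best))
qed

definition edge :: "'a \<Rightarrow> 'a \<Rightarrow> real \<Rightarrow> real" where
  "edge a b y = abscissa a + (y - height a) / (height b - height a) * (abscissa b - abscissa a)"

lemma edge_ends:
  "edge a b (height a) = abscissa a" "covered_by a b \<Longrightarrow> edge a b (height b) = abscissa b"
  using height_cover[of a b] by (auto simp: edge_def)

lemma curve_edge:
  assumes "covered_by a b"
  shows "curve {a, b} (edge a b) (height a) (height b)"
  unfolding curve_def
proof
  have lt: "height a < height b" by (rule height_cover[OF assms])
  show "continuous_on {height a..height b} (edge a b)"
    unfolding edge_def by (intro continuous_intros) (use lt in auto)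
  show "\<forall>y\<in>{height a..height b}. \<exists>c\<in>{a, b}. \<exists>d\<in>{a, b}. link c d \<and>
      (edge a b y, y) \<in> closed_segment (pos c) (pos d)"
  proof
    fix y assume y: "y \<in> {height a..height b}"
    define u where "u = (y - height a) / (height b - height a)"
    have "0 \<le> u" "u \<le> 1" using y lt by (auto simp: u_def divide_simps)
    moreover have "u * (height b - height a) = y - height a" using lt by (simp add: u_def)
    then have "(edge a b y, y) = (1 - u) *\<^sub>R pos a + u *\<^sub>R pos b"
      by (simp add: pos_eq edge_def u_def[symmetric] algebra_simps)
    ultimately have "(edge a b y, y) \<in> closed_segment (pos a) (pos b)"
      unfolding closed_segment_def by blast
    then show "\<exists>c\<in>{a, b}. \<exists>d\<in>{a, b}. link c d \<and>
      (edge a b y, y) \<in> closed_segment (pos c) (pos d)"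
      using assms by (auto simp: link_def)
  qed
qed

lemma chain_curve:
  assumes "a \<le> b"
  obtains f where "curve {a..b} f (height a) (height b)" "f (height a) = abscissa a" "f (height b) = abscissa b"
proof -
  have "\<exists>f. curve {a..b} f (height a) (height b) \<and> f (height a) = abscissa a \<and> f (height b) = abscissa b"
    using assms
  proof (induction rule: cover_induct_down)
    case top
    have "curve {b..b} (\<lambda>_. abscissa b) (height b) (height b)"
      by (simp add: curve_def link_def pos_eq)
    then show ?case by blast
  next
    case (cover a c)
    then obtain f where f: "curve {c..b} f (height c) (height b)" "f (height c) = abscissa c" "f (height b) = abscissa b"
      by blast
    let ?g = "\<lambda>y. if y \<le> height c then edge a c y else f y"
    have "curve ({a, c} \<union> {c..b}) ?g (height a) (height b)"
      using f by (intro curve_join curve_edge cover) (simp_all add: edge_ends(2)[OF cover(1)])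
    moreover have "{a, c} \<union> {c..b} \<subseteq> {a..b}"
      using cover covered_by_less[of a c] by auto
    ultimately have "curve {a..b} ?g (height a) (height b)"
      unfolding curve_def by blast
    moreover have "?g (height a) = abscissa a" "?g (height b) = abscissa b"
      using f height_cover[OF cover(1)] height_mono[OF cover(2)] edge_ends[of a c] cover(1)
      by auto
    ultimately show ?case by blast
  qed
  then show ?thesis using that by blast
qed

text \<open>The form in which planarity is used below. It suffices that the common vertices all lie below
  the strip or all above it: an edge shared inside the strip would have one end on each side of the
  crossing.\<close>

lemma curves_keep_sides:
  assumes f: "curve V f s t" and g: "curve W g s t" and "s \<le> t"
    and disj: "(\<forall>z \<in> V \<inter> W. height z < s) \<or> (\<forall>z \<in> V \<inter> W. t < height z)"
  shows "f s < g s \<longleftrightarrow> f t < g t"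
proof (rule no_meeting_sides)
  show "continuous_on {s..t} f" "continuous_on {s..t} g"
    using f g by (simp_all add: curve_def)
  show "f y \<noteq> g y" if "s \<le> y" "y \<le> t" for y
    using curves_meet[OF f g, of y] disj that by force
qed fact

text \<open>The first edge of the curve is prescribed, so that near \<open>x\<close> its position is known from the
  direction of that edge.\<close>

lemma curve_starting_with_edge:
  assumes "covered_by x a" "a \<le> j"
  obtains f where "curve ({x} \<union> {a..j}) f (height x) (height j)" "\<And>y. y \<le> height a \<Longrightarrow> f y = edge x a y"
    "f (height j) = abscissa j"
proof -
  obtain f where f: "curve {a..j} f (height a) (height j)" "f (height a) = abscissa a" "f (height j) = abscissa j"
    using chain_curve[OF assms(2)] .
  let ?g = "\<lambda>y. if y \<le> height a then edge x a y else f y"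
  have "curve ({x, a} \<union> {a..j}) ?g (height x) (height j)"
    using f by (intro curve_join curve_edge assms) (simp_all add: edge_ends(2)[OF assms(1)])
  moreover have "{x, a} \<union> {a..j} = {x} \<union> {a..j}"
    using assms by auto
  moreover have "?g (height j) = abscissa j"
    using f height_mono[OF assms(2)] edge_ends(2)[OF assms(1)] by auto
  ultimately show ?thesis
    using that[of ?g] by simp
qed

lemma curve_ending_with_edge:
  assumes "j \<le> a" "covered_by a u"
  obtains f where "curve ({j..a} \<union> {u}) f (height j) (height u)" "\<And>y. height a \<le> y \<Longrightarrow> f y = edge a u y"
    "f (height j) = abscissa j"
proof -
  obtain f where f: "curve {j..a} f (height j) (height a)" "f (height j) = abscissa j" "f (height a) = abscissa a"
    using chain_curve[OF assms(1)] .
  let ?g = "\<lambda>y. if y \<le> height a then f y else edge a u y"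
  have "curve ({j..a} \<union> {a, u}) ?g (height j) (height u)"
    using f by (intro curve_join curve_edge assms) (simp_all add: edge_ends(1))
  moreover have "{j..a} \<union> {a, u} = {j..a} \<union> {u}"
    using assms by auto
  moreover have "?g (height j) = abscissa j"
    using f height_mono[OF assms(1)] by auto
  moreover have "?g y = edge a u y" if "height a \<le> y" for y
    using that f(3) by (auto simp: edge_ends(1))
  ultimately show ?thesis
    using that[of ?g] by simp
qed

section \<open>Three covers in a planar lattice\<close>

text \<open>The counterpart of \<open>edge_run\<close> for edges leaving \<open>x\<close> upwards; it orders the upper covers
  of \<open>x\<close> from left to right.\<close>

definition slope :: "'a \<Rightarrow> 'a \<Rightarrow> real" where
  "slope x a = (abscissa a - abscissa x) / (height a - height x)"

lemma edge_slope: "edge x a y = abscissa x + (y - height x) * slope x a"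
  by (simp add: edge_def slope_def)

lemma edge_edge_run:
  assumes "covered_by a u"
  shows "edge a u y = abscissa u + (height u - y) * edge_run pos u a"
proof -
  have run: "edge_run pos u a = (abscissa a - abscissa u) / (height u - height a)"
    by (simp add: edge_run_def abscissa_def height_def)
  show ?thesis
    unfolding edge_def run using height_cover[OF assms] by (simp add: field_simps)
qed

lemma slope_inj:
  assumes "covered_by x a" "covered_by x b" "slope x a = slope x b"
  shows "a = b"
proof -
  define y where "y = min (height a) (height b)"
  have y: "height x < y" "y \<le> height a" "y \<le> height b"
    using height_cover assms by (auto simp: y_def)
  then obtain z where "z \<in> {x, a} \<inter> {x, b}" "y \<le> height z"
    using curves_meet(1)[OF curve_edge[OF assms(1)] curve_edge[OF assms(2)], of y] assms(3)
    by (auto simp: edge_slope)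
  then show ?thesis
    using y by auto
qed

lemma edge_run_inj:
  assumes "covered_by a u" "covered_by b u" "edge_run pos u a = edge_run pos u b"
  shows "a = b"
proof -
  define y where "y = max (height a) (height b)"
  have y: "y < height u" "height a \<le> y" "height b \<le> y"
    using height_cover assms by (auto simp: y_def)
  then obtain z where "z \<in> {a, u} \<inter> {b, u}" "height z \<le> y"
    using curves_meet(2)[OF curve_edge[OF assms(1)] curve_edge[OF assms(2)], of y]
      edge_edge_run[OF assms(1)] edge_edge_run[OF assms(2)] assms(3)
    by auto
  then show ?thesis
    using y by auto
qed

text \<open>Otherwise a chain from \<open>x\<close> through \<open>b\<close>, continued to the height of \<open>sup a c\<close>, would
  remain strictly between chains from \<open>x\<close> through \<open>a\<close> and through \<open>c\<close>, although those two
  end in the same point \<open>sup a c\<close>.\<close>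

lemma middle_upper_cover_le_sup:
  assumes "covered_by x a" "covered_by x b" "covered_by x c"
    and "slope x a < slope x b" "slope x b < slope x c"
  shows "b \<le> sup a c"
proof (rule ccontr)
  assume nb: "\<not> b \<le> sup a c"
  define j where "j = sup a c"
  have j: "a \<le> j" "c \<le> j" "j \<le> sup b j"
    by (simp_all add: j_def)
  obtain L where L: "curve ({x} \<union> {a..j}) L (height x) (height j)" "\<And>y. y \<le> height a \<Longrightarrow> L y = edge x a y"
      "L (height j) = abscissa j"
    using curve_starting_with_edge[OF assms(1) j(1)] by metis
  obtain R where R: "curve ({x} \<union> {c..j}) R (height x) (height j)" "\<And>y. y \<le> height c \<Longrightarrow> R y = edge x c y"
      "R (height j) = abscissa j"
    using curve_starting_with_edge[OF assms(3) j(2)] by metis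
  obtain B where B: "curve ({x} \<union> {b..sup b j}) B (height x) (height (sup b j))"
      "\<And>y. y \<le> height b \<Longrightarrow> B y = edge x b y"
    using curve_starting_with_edge[OF assms(2), of "sup b j"] by (metis sup_ge1)
  \<comment> \<open>Below this height all three curves run along their first edges, so their order is that of the slopes.\<close>
  define m where "m = min (height a) (min (height b) (height c))"
  have m: "height x < m" "m \<le> height a" "m \<le> height b" "m \<le> height c" "m \<le> height j"
    using height_cover assms height_mono[OF j(1)] by (auto simp: m_def)
  have start: "L m < B m" "B m < R m"
    using m assms(4,5) L(2) B(2) R(2) by (simp_all add: edge_slope)
  have L': "curve ({x} \<union> {a..j}) L m (height j)" and R': "curve ({x} \<union> {c..j}) R m (height j)"
    and B': "curve ({x} \<union> {b..sup b j}) B m (height j)"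
    using m height_mono[OF j(3)] by - (rule curve_sub[OF L(1)] curve_sub[OF R(1)] curve_sub[OF B(1)]; linarith)+
  have common: "height z < m" if "z \<in> ({x} \<union> {a..j}) \<union> ({x} \<union> {c..j})" "z \<in> {x} \<union> {b..sup b j}" for z
  proof -
    have "z \<le> j" using that(1) j covered_by_less[OF assms(1)] by (auto intro: less_imp_le less_le_trans)
    then have "\<not> b \<le> z" using nb j_def by (auto dest: order_trans)
    then show ?thesis using that(2) m by auto
  qed
  have "L (height j) < B (height j)"
    using curves_keep_sides[OF L' B'] start(1) m common by blast
  moreover have "B (height j) < R (height j)"
    using curves_keep_sides[OF B' R'] start(2) m common by blast
  ultimately show False
    using L R by simp
qed

text \<open>The situation shared by the next two lemmas: \<open>b\<close> lies strictly between a left chain through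
  \<open>a\<close> and a right chain through \<open>c\<close>, which both join \<open>inf a c\<close> to \<open>u\<close>. It is found by following
  the edge from \<open>u\<close> down to \<open>b\<close>, which cannot meet either chain. It cannot pass below
  \<open>inf a c\<close> either, for there the two chains come together.\<close>

lemma middle_lower_cover_enclosed:
  assumes "covered_by a u" "covered_by b u" "covered_by c u"
    and "edge_run pos u a < edge_run pos u b" "edge_run pos u b < edge_run pos u c"
  obtains L R where "curve ({inf a c..a} \<union> {u}) L (height (inf a c)) (height u)"
    "curve ({inf a c..c} \<union> {u}) R (height (inf a c)) (height u)"
    "L (height (inf a c)) = R (height (inf a c))" "L (height u) = R (height u)"
    "height (inf a c) < height b" "L (height b) < abscissa b" "abscissa b < R (height b)"
proof -
  define j where "j = inf a c"
  have j: "j \<le> a" "j \<le> c"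
    by (simp_all add: j_def)
  obtain L where L: "curve ({j..a} \<union> {u}) L (height j) (height u)" "\<And>y. height a \<le> y \<Longrightarrow> L y = edge a u y"
      "L (height j) = abscissa j"
    using curve_ending_with_edge[OF j(1) assms(1)] by metis
  obtain R where R: "curve ({j..c} \<union> {u}) R (height j) (height u)" "\<And>y. height c \<le> y \<Longrightarrow> R y = edge c u y"
      "R (height j) = abscissa j"
    using curve_ending_with_edge[OF j(2) assms(3)] by metis
  let ?E = "edge b u"
  have hu: "height a < height u" "height b < height u" "height c < height u" "height j \<le> height a"
    using height_cover assms height_mono[OF j(1)] by auto
  define s where "s = max (height j) (height b)"
  define t where "t = max (height a) (max (height b) (height c))"
  have t: "height a \<le> t" "height b \<le> t" "height c \<le> t" "t < height u" "s \<le> t" "height j \<le> s" "height b \<le> s"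
    using hu by (auto simp: t_def s_def)
  have "L t < ?E t" "?E t < R t"
    using t assms(4,5) L(2) R(2)
    by (simp_all add: edge_edge_run[OF assms(1)] edge_edge_run[OF assms(2)] edge_edge_run[OF assms(3)])
  moreover have L': "curve ({j..a} \<union> {u}) L s t" and R': "curve ({j..c} \<union> {u}) R s t"
    and E': "curve {b, u} ?E s t"
    using t by - (rule curve_sub[OF L(1)] curve_sub[OF R(1)] curve_sub[OF curve_edge[OF assms(2)]]; linarith)+
  moreover have "t < height z" if "z \<in> ({j..a} \<union> {u}) \<union> ({j..c} \<union> {u})" "z \<in> {b, u}" for z
  proof -
    have "\<not> b \<le> a" "\<not> b \<le> c"
      using covered_by_not_le' assms by blast+
    then show ?thesis using that t by auto
  qed
  ultimately have s: "L s < ?E s" "?E s < R s"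
    using curves_keep_sides[OF L' E' \<open>s \<le> t\<close>] curves_keep_sides[OF E' R' \<open>s \<le> t\<close>] by blast+
  then have "s \<noteq> height j"
    using L(3) R(3) by auto
  then have "s = height b" "height j < height b"
    by (auto simp: s_def max_def split: if_splits)
  moreover have "L (height u) = R (height u)"
    using L(2)[of "height u"] R(2)[of "height u"] hu edge_ends(2)[OF assms(1)] edge_ends(2)[OF assms(3)]
    by simp
  ultimately show ?thesis
    using that[of L R] L R s edge_ends(1)[of b u] by (simp add: j_def)
qed

text \<open>A chain descending from \<open>b\<close> is caught between the two chains, so it must meet one of them at
  some element above \<open>inf a c\<close>. It is taken down to \<open>inf b (inf a c)\<close> only to make sure that it is long
  enough.\<close>

lemma inf_le_middle_lower_cover:
  assumes "covered_by a u" "covered_by b u" "covered_by c u"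
    and "edge_run pos u a < edge_run pos u b" "edge_run pos u b < edge_run pos u c"
  shows "inf a c \<le> b"
proof (rule ccontr)
  assume nb: "\<not> inf a c \<le> b"
  define j where "j = inf a c"
  obtain L R where LR: "curve ({j..a} \<union> {u}) L (height j) (height u)" "curve ({j..c} \<union> {u}) R (height j) (height u)"
      "L (height j) = R (height j)" "height j < height b" "L (height b) < abscissa b" "abscissa b < R (height b)"
    using middle_lower_cover_enclosed[OF assms] unfolding j_def by metis
  have k: "inf b j \<le> b" "height (inf b j) \<le> height j"
    by (simp_all add: height_mono)
  obtain B where B: "curve {inf b j..b} B (height (inf b j)) (height b)" "B (height b) = abscissa b"
    using chain_curve[OF k(1)] by metis
  have hu: "height b < height u" using height_cover assms by blast
  have L': "curve ({j..a} \<union> {u}) L (height j) (height b)" and R': "curve ({j..c} \<union> {u}) R (height j) (height b)"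
    and B': "curve {inf b j..b} B (height j) (height b)"
    using k hu by - (rule curve_sub[OF LR(1)] curve_sub[OF LR(2)] curve_sub[OF B(1)]; linarith)+
  have common: "height b < height z" if "z \<in> ({j..a} \<union> {u}) \<union> ({j..c} \<union> {u})" "z \<in> {inf b j..b}" for z
    using that nb hu unfolding j_def by (auto dest: order_trans)
  have "L (height j) < B (height j)"
    using curves_keep_sides[OF L' B'] LR B(2) common by (metis IntE UnI1 less_imp_le)
  moreover have "B (height j) < R (height j)"
    using curves_keep_sides[OF B' R'] LR B(2) common by (metis IntE UnI2 less_imp_le)
  ultimately show False
    using LR(3) by simp
qed

text \<open>A chain that ascends from \<open>b\<close> through a cover other than \<open>u\<close> would be caught between the two chains:
  it avoids \<open>u\<close>, and the other elements of the two chains lie below \<open>a\<close> or \<open>c\<close>, hence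
  not above \<open>b\<close>.\<close>

lemma middle_lower_cover_unique_cover:
  assumes "covered_by a u" "covered_by b u" "covered_by c u"
    and "edge_run pos u a < edge_run pos u b" "edge_run pos u b < edge_run pos u c"
    and e: "covered_by b e"
  shows "e = u"
proof (rule ccontr)
  assume "e \<noteq> u"
  then have ne: "\<not> e \<le> u"
    using covered_by_not_le e assms(2) by blast
  define j where "j = inf a c"
  obtain L R where LR: "curve ({j..a} \<union> {u}) L (height j) (height u)" "curve ({j..c} \<union> {u}) R (height j) (height u)"
      "L (height u) = R (height u)" "height j < height b" "L (height b) < abscissa b" "abscissa b < R (height b)"
    using middle_lower_cover_enclosed[OF assms(1-5)] unfolding j_def by metis
  obtain B where B: "curve ({b} \<union> {e..sup e u}) B (height b) (height (sup e u))"
      "\<And>y. y \<le> height e \<Longrightarrow> B y = edge b e y"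
    using curve_starting_with_edge[OF e, of "sup e u"] by (metis sup_ge1)
  have Bb: "B (height b) = abscissa b"
    using B(2) height_cover[OF e] edge_ends(1) by simp
  have hu: "height b < height u" "height u \<le> height (sup e u)" using height_cover assms height_mono by auto
  have L': "curve ({j..a} \<union> {u}) L (height b) (height u)" and R': "curve ({j..c} \<union> {u}) R (height b) (height u)"
    and B': "curve ({b} \<union> {e..sup e u}) B (height b) (height u)"
    using LR(4) hu by - (rule curve_sub[OF LR(1)] curve_sub[OF LR(2)] curve_sub[OF B(1)]; linarith)+
  have disjoint: "z \<notin> {b} \<union> {e..sup e u}" if "z \<in> ({j..a} \<union> {u}) \<union> ({j..c} \<union> {u})" for z
  proof -
    have "\<not> b \<le> a" "\<not> b \<le> c" "a < u" "c < u" "b < u"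
      using covered_by_not_le' covered_by_less assms by blast+
    moreover have "z \<le> u"
      using that \<open>a < u\<close> \<open>c < u\<close> by (auto dest: less_imp_le order_trans)
    ultimately show ?thesis using that ne by (auto dest: order_trans)
  qed
  have "L (height u) < B (height u)"
    using curves_keep_sides[OF L' B'] LR(5) Bb disjoint hu(1) by (metis IntE UnI1 less_imp_le)
  moreover have "B (height u) < R (height u)"
    using curves_keep_sides[OF B' R'] LR(6) Bb disjoint hu(1) by (metis IntE UnI2 less_imp_le)
  ultimately show False
    using LR(3) by simp
qed

end

section \<open>Covers in a slim planar semimodular lattice\<close>

context sps_lattice
begin

sublocale planar_lattice pos
  by unfold_locales (rule planar)

lemma cover_sup:
  fixes x a c :: 'a
  assumes "covered_by x a" "\<not> a \<le> sup x c"
  shows "covered_by (sup x c) (sup a c)"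
  using semimodular[OF assms(1), of c] assms(2) by (metis sup_ge1)

text \<open>By semimodularity \<open>sup a b\<close> and \<open>sup c b\<close> properly exceed \<open>a\<close> and \<open>c\<close>; both are below
  \<open>sup a c\<close>, which covers \<open>a\<close> and \<open>c\<close>, so all three joins coincide.\<close>

lemma three_upper_covers_embed_m3:
  fixes x a b c :: 'a
  assumes "covered_by x a" "covered_by x b" "covered_by x c"
    and "a \<noteq> b" "b \<noteq> c" "a \<noteq> c" and "b \<le> sup a c"
  shows "\<exists>f :: m3 \<Rightarrow> 'a. lattice_embedding f"
proof -
  have cov: "covered_by p (sup p q)"
    if "covered_by x p" "covered_by x q" "p \<noteq> q" for p q :: 'a
  proof -
    have "sup x p = p" "\<not> q \<le> p"
      using covered_by_not_le[OF that(2,1)] covered_by_less[OF that(1)] that(3)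
      by (auto simp: sup_absorb2 less_imp_le)
    then show ?thesis
      using cover_sup[of x q p] that by (simp add: sup_commute)
  qed
  define j where "j = sup a c"
  have below: "covered_by a (sup a b)" "covered_by c (sup c b)" "covered_by a j" "covered_by c j"
    using cov[of a b] cov[of c b] cov[of a c] cov[of c a] assms by (auto simp: j_def sup_commute)
  have "sup a b = j" "sup c b = j"
    using covered_by_between[OF below(3), of "sup a b"] covered_by_between[OF below(4), of "sup c b"]
      below(1,2) assms(7) by (auto simp: j_def covered_by_def)
  then have sups: "sup a b = j" "sup b a = j" "sup b c = j" "sup c b = j" "sup a c = j" "sup c a = j"
    by (simp_all add: sup_commute j_def)
  have infs: "inf a b = x" "inf b a = x" "inf b c = x" "inf c b = x" "inf a c = x" "inf c a = x"
    using inf_covers assms by metis+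
  have le: "x \<le> a" "x \<le> b" "x \<le> c" "a \<le> j" "b \<le> j" "c \<le> j" "x \<le> j"
    using assms(1-3,7) by (auto simp: j_def covered_by_def intro: less_imp_le le_supI1)
  have ne: "x \<noteq> a" "x \<noteq> b" "x \<noteq> c" "a \<noteq> j" "c \<noteq> j"
    using assms below by (auto simp: covered_by_def)
  have "b \<noteq> j"
    using covered_by_not_le[OF assms(1,2,4)] le by auto
  define f where "f y = (case y of M3_Bot \<Rightarrow> x | M3_A \<Rightarrow> a | M3_B \<Rightarrow> b | M3_C \<Rightarrow> c | M3_Top \<Rightarrow> j)" for y
  have "x \<noteq> j"
    using ne le by auto
  then have "inj f"
    using ne \<open>b \<noteq> j\<close> assms(4-6) unfolding inj_def f_def by (auto split: m3.splits)
  moreover have "f (inf y z) = inf (f y) (f z) \<and> f (sup y z) = sup (f y) (f z)" for y z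
    using le infs sups
    by (cases y; cases z)
      (simp_all add: f_def inf_m3_def sup_m3_def less_eq_m3_def inf_absorb1 inf_absorb2 sup_absorb1 sup_absorb2)
  ultimately show ?thesis
    unfolding lattice_embedding_def by blast
qed

text \<open>Of three covers of \<open>x\<close> the middle one would lie below the join of the outer ones, which gives a
  sublattice \<open>M\<^sub>3\<close>.\<close>

lemma two_upper_covers:
  fixes x a b c :: 'a
  assumes "covered_by x a" "covered_by x b" "covered_by x c" "a \<noteq> b" "a \<noteq> c"
  shows "b = c"
proof (rule ccontr)
  assume "b \<noteq> c"
  have no: False if "covered_by x p" "covered_by x q" "covered_by x r"
      "slope x p < slope x q" "slope x q < slope x r" for p q r
  proof -
    have "p \<noteq> q" "q \<noteq> r" "p \<noteq> r"
      using that(4,5) by auto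
    then show False
      using three_upper_covers_embed_m3[OF that(1-3)] middle_upper_cover_le_sup[OF that] slim
      by blast
  qed
  have "slope x a \<noteq> slope x b" "slope x a \<noteq> slope x c" "slope x b \<noteq> slope x c"
    using slope_inj assms \<open>b \<noteq> c\<close> by blast+
  then show False
    using no assms by (metis linorder_neqE_linordered_idom)
qed

text \<open>Of three lower covers one is in the middle, and it contains the meet of the other two. The
  last two hypotheses therefore exclude \<open>a\<close> and \<open>c\<close> from the middle, without any reference to the
  diagram.\<close>

lemma swingsI:
  assumes "covered_by a u" "covered_by b u" "covered_by c u" "a \<noteq> b" "b \<noteq> c" "a \<noteq> c"
    and "\<not> inf b c \<le> a" "\<not> inf b a \<le> c"
  shows "swings pos (a, u) (b, u)"
proof -
  have runs: "edge_run pos u a \<noteq> edge_run pos u b" "edge_run pos u b \<noteq> edge_run pos u c"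
    "edge_run pos u a \<noteq> edge_run pos u c"
    using edge_run_inj assms by blast+
  have mid: "edge_run pos u a < edge_run pos u b \<and> edge_run pos u b < edge_run pos u c \<or>
    edge_run pos u c < edge_run pos u b \<and> edge_run pos u b < edge_run pos u a"
    using runs assms inf_le_middle_lower_cover inf_commute
    by (metis linorder_neqE_linordered_idom)
  have "card {a, b, c} = 3"
    using assms by simp
  moreover have "{a, b, c} \<subseteq> lower_covers u"
    using assms by (simp add: lower_covers_def)
  ultimately have "3 \<le> card (lower_covers u)"
    by (metis card_mono finite)
  moreover have "a \<in> lower_covers u - {b}" "c \<in> lower_covers u - {b}"
    using assms by (auto simp: lower_covers_def)
  then have "\<not> leftmost_lower_cover pos u b" "\<not> rightmost_lower_cover pos u b"
    unfolding leftmost_lower_cover_def rightmost_lower_cover_def using mid by (meson less_asym)+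
  ultimately show ?thesis
    using assms by (simp add: swings_def prime_interval_def)
qed

lemma swings_middle:
  assumes "swings pos (a, u) (b, v)"
  obtains c d where "covered_by c u" "covered_by d u" "covered_by b u" "v = u"
    "edge_run pos u c < edge_run pos u b" "edge_run pos u b < edge_run pos u d"
proof -
  have *: "covered_by b u" "v = u"
    using assms by (auto simp: swings_def prime_interval_def)
  then have "b \<in> lower_covers u" by (simp add: lower_covers_def)
  with assms obtain c d where cd: "c \<in> lower_covers u - {b}" "d \<in> lower_covers u - {b}"
      "\<not> edge_run pos u b < edge_run pos u c" "\<not> edge_run pos u d < edge_run pos u b"
    unfolding swings_def leftmost_lower_cover_def rightmost_lower_cover_def by auto
  have "covered_by c u" "covered_by d u"
    using cd by (auto simp: lower_covers_def)
  moreover have "edge_run pos u b \<noteq> edge_run pos u c" "edge_run pos u b \<noteq> edge_run pos u d"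
    using edge_run_inj calculation *(1) cd(1,2) by blast+
  ultimately show ?thesis
    using that * cd(3,4) by auto
qed

section \<open>Soundness of perspectivities and swings\<close>

lemma up_perspective_collapses:
  assumes "congruence \<theta>" "up_perspective I J" "collapses \<theta> I"
  shows "collapses \<theta> J"
proof -
  have "(fst J, fst J) \<in> \<theta>"
    using assms(1) by (auto simp: congruence_def equiv_def refl_on_def)
  then have "(sup (fst I) (fst J), sup (snd I) (fst J)) \<in> \<theta>"
    using assms unfolding congruence_def collapses_def by blast
  moreover have "sup (fst I) (fst J) = fst J"
    using assms(2) by (simp add: up_perspective_def sup_absorb2)
  ultimately show ?thesis
    using assms(2) by (simp add: up_perspective_def collapses_def)
qed

lemma down_perspective_collapses:
  assumes "congruence \<theta>" "down_perspective I J" "collapses \<theta> I"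
  shows "collapses \<theta> J"
proof -
  have "(snd J, snd J) \<in> \<theta>"
    using assms(1) by (auto simp: congruence_def equiv_def refl_on_def)
  then have "(inf (fst I) (snd J), inf (snd I) (snd J)) \<in> \<theta>"
    using assms unfolding congruence_def collapses_def by blast
  moreover have "inf (snd I) (snd J) = snd J"
    using assms(2) by (simp add: down_perspective_def inf_absorb2)
  ultimately show ?thesis
    using assms(2) by (simp add: down_perspective_def collapses_def)
qed

text \<open>Let \<open>e\<close> be a lower cover of \<open>u\<close> on the other side of \<open>b\<close> from \<open>a\<close>. Meeting the pair
  \<open>(a, u)\<close> with \<open>e\<close> identifies \<open>inf a e\<close> with \<open>e\<close>; as \<open>inf a e \<le> b\<close>, joining with \<open>b\<close>
  identifies \<open>b\<close> with \<open>u\<close>.\<close>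

lemma swings_collapses:
  assumes "congruence \<theta>" "swings pos (a, u) (b, v)" "(a, u) \<in> \<theta>"
  shows "(b, v) \<in> \<theta>"
proof (cases "a = b")
  case True
  then show ?thesis using assms by (simp add: swings_def)
next
  case False
  obtain c d where cd: "covered_by c u" "covered_by d u" "covered_by b u" "v = u"
      "edge_run pos u c < edge_run pos u b" "edge_run pos u b < edge_run pos u d"
    using swings_middle[OF assms(2)] by metis
  have a: "covered_by a u"
    using assms(2) by (auto simp: swings_def prime_interval_def)
  then have "edge_run pos u a \<noteq> edge_run pos u b"
    using edge_run_inj cd(3) False by blast
  then consider "edge_run pos u a < edge_run pos u b" | "edge_run pos u b < edge_run pos u a"
    by linarith
  then obtain e where e: "covered_by e u" "inf a e \<le> b" "e \<noteq> b"
  proof cases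
    case 1
    then show ?thesis
      using that[of d] inf_le_middle_lower_cover[OF a cd(3,2)] cd by auto
  next
    case 2
    then show ?thesis
      using that[of c] inf_le_middle_lower_cover[OF cd(1,3) a] cd by (auto simp: inf_commute)
  qed
  have refl: "(z, z) \<in> \<theta>" for z
    using assms(1) by (auto simp: congruence_def equiv_def refl_on_def)
  have "(inf a e, inf u e) \<in> \<theta>"
    using assms(1,3) refl unfolding congruence_def by blast
  then have "(sup (inf a e) b, sup (inf u e) b) \<in> \<theta>"
    using assms(1) refl unfolding congruence_def by blast
  moreover have "sup (inf a e) b = b"
    using e(2) by (simp add: sup_absorb2)
  moreover have "inf u e = e"
    using e(1) by (simp add: inf_absorb2 covered_by_less less_imp_le)
  moreover have "\<not> e \<le> b"
    using covered_by_not_le'[OF e(1) cd(3) e(3)] .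
  then have "sup e b = u"
    using covered_by_between[OF cd(3), of "sup e b"] e(1) cd(3)
    by (metis covered_by_less less_imp_le sup_ge1 sup_ge2 sup_least)
  ultimately show ?thesis
    using cd(4) by simp
qed

section \<open>Prime intervals reachable from a given one\<close>

definition step :: "'a \<times> 'a \<Rightarrow> 'a \<times> 'a \<Rightarrow> bool" where
  "step r s \<longleftrightarrow> prime_interval s \<and> (down_perspective r s \<or> swings pos r s)"

definition reach :: "'a \<times> 'a \<Rightarrow> ('a \<times> 'a) set" where
  "reach p = {q. \<exists>r. prime_interval r \<and> up_perspective p r \<and> step\<^sup>*\<^sup>* r q}"

lemma reach_step: "q \<in> reach p \<Longrightarrow> step q s \<Longrightarrow> s \<in> reach p"
  unfolding reach_def by (auto intro: rtranclp.rtrancl_into_rtrancl)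

lemma reach_cover:
  assumes "(a, b) \<in> reach p"
  shows "covered_by a b"
proof -
  obtain r where "prime_interval r" "step\<^sup>*\<^sup>* r (a, b)"
    using assms unfolding reach_def by blast
  then have "prime_interval (a, b)"
    by (metis rtranclp.cases step_def)
  then show ?thesis
    by (simp add: prime_interval_def)
qed

text \<open>For prime intervals, down-perspectivity needs only these inequalities, since the covering
  relations force the equations.\<close>

lemma reach_down:
  assumes "(c, d) \<in> reach p" "covered_by a b" "b \<le> d" "a \<le> c" "\<not> b \<le> c"
  shows "(a, b) \<in> reach p"
proof -
  have "c < sup c b"
    using assms(5) by (metis less_le sup_ge1 sup_ge2)
  moreover have "sup c b \<le> d"
    using assms(3) covered_by_less[OF reach_cover[OF assms(1)]] by simp
  ultimately have "d = sup c b"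
    using covered_by_between[OF reach_cover[OF assms(1)], of "sup c b"] by auto
  moreover have "inf c b \<noteq> b"
    using assms(5) by (metis inf_le1)
  moreover have "a \<le> inf c b"
    using assms(4) covered_by_less[OF assms(2)] by (simp add: less_imp_le)
  ultimately have "a = inf c b"
    using covered_by_between[OF assms(2), of "inf c b"] by auto
  with \<open>d = sup c b\<close> have "step (c, d) (a, b)"
    using assms(2) by (simp add: step_def down_perspective_def prime_interval_def)
  then show ?thesis
    using assms(1) reach_step by blast
qed

text \<open>Induction on the sequence leading to \<open>[a, b]\<close>. If its last member was reached by a
  down-perspectivity from some \<open>[c, d]\<close> with \<open>c \<noteq> a\<close>, then \<open>e\<close> lies below \<open>c\<close>, because \<open>a\<close> has
  no upper covers besides \<open>b\<close> and the one towards \<open>c\<close>; hence \<open>[e, sup b e]\<close> is down-perspective from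
  \<open>[c, d]\<close>. After a swing there is no such \<open>e\<close>.\<close>

lemma reach_up_cover:
  assumes "(a, b) \<in> reach p" "covered_by a e" "e \<noteq> b"
  shows "(e, sup b e) \<in> reach p"
proof -
  obtain r where r: "prime_interval r" "up_perspective p r" "step\<^sup>*\<^sup>* r (a, b)"
    using assms(1) unfolding reach_def by blast
  have "\<forall>e. covered_by (fst q) e \<longrightarrow> e \<noteq> snd q \<longrightarrow> (e, sup (snd q) e) \<in> reach p"
    if "step\<^sup>*\<^sup>* r q" for q
    using that
  proof (induction rule: rtranclp_induct)
    case base
    show ?case
    proof (intro allI impI)
      fix e assume e: "covered_by (fst r) e" "e \<noteq> snd r"
      have c: "covered_by (fst r) (snd r)"
        using r(1) by (simp add: prime_interval_def)
      have "\<not> snd r \<le> e"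
        using covered_by_not_le[OF c e(1)] e(2) by auto
      then have cov: "covered_by e (sup (snd r) e)"
        using cover_sup[OF c, of e] covered_by_less[OF e(1)] by (simp add: sup_absorb2 less_imp_le)
      have p: "fst p = inf (snd p) (fst r)" "snd r = sup (snd p) (fst r)"
        using r(2) by (simp_all add: up_perspective_def)
      have re: "fst r \<le> e"
        using e(1) by (simp add: covered_by_def less_imp_le)
      have "inf (snd p) e \<le> inf (snd r) e"
        using p(2) by (simp add: inf.coboundedI1)
      also have "\<dots> = fst r"
        using inf_covers[OF c e(1)] e(2) by simp
      finally have "inf (snd p) e = fst p"
        using re p(1) by (metis inf.absorb_iff2 inf.absorb_iff1 inf.left_commute inf.assoc inf_commute)
      moreover have "sup (snd r) e = sup (snd p) e"
        using p(2) re by (simp add: sup_assoc sup_absorb2)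
      ultimately have "up_perspective p (e, sup (snd r) e)"
        by (simp add: up_perspective_def)
      then show "(e, sup (snd r) e) \<in> reach p"
        using cov unfolding reach_def prime_interval_def by auto
    qed
  next
    case (step q s)
    obtain c d a b where q: "q = (c, d)" and s: "s = (a, b)" by (metis surj_pair)
    have qr: "(c, d) \<in> reach p"
      using r step.hyps(1) q unfolding reach_def by blast
    have ab: "covered_by a b"
      using step.hyps(2) s by (simp add: step_def prime_interval_def)
    show ?case unfolding s
    proof (intro allI impI, simp)
      fix e assume e: "covered_by a e" "e \<noteq> b"
      show "(e, sup b e) \<in> reach p"
      proof (cases "swings pos (c, d) (a, b)")
        case True
        then obtain x y where "covered_by x d" "covered_by y d" "covered_by a d" "b = d"
            "edge_run pos d x < edge_run pos d a" "edge_run pos d a < edge_run pos d y"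
          using swings_middle by metis
        then show ?thesis
          using middle_lower_cover_unique_cover e by blast
      next
        case False
        then have down: "d = sup c b" "a = inf c b"
          using step.hyps(2) q s by (simp_all add: step_def down_perspective_def)
        show ?thesis
        proof (cases "a = c")
          case True
          then have "b = d"
            using down ab by (simp add: sup_absorb2 covered_by_less less_imp_le)
          then show ?thesis
            using True step.IH q e by simp
        next
          case False
          then have "a < c" using down by (simp add: less_le)
          then obtain e' where e': "covered_by a e'" "e' \<le> c"
            using cover_above_below by metis
          have bc: "\<not> b \<le> c"
            using down(2) covered_by_less[OF ab] by (auto simp: inf_absorb2)
          then have "e' \<noteq> b" using e' by auto
          then have "e \<le> c"
            using two_upper_covers[OF ab e(1) e'(1)] e e' by auto
          moreover have "\<not> b \<le> e"
            using covered_by_not_le[OF ab e(1)] e(2) by auto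
          then have "covered_by e (sup b e)"
            using cover_sup[OF ab, of e] covered_by_less[OF e(1)] by (simp add: sup_absorb2 less_imp_le)
          ultimately show ?thesis
            using reach_down[OF qr, of e "sup b e"] bc down(1) by (auto intro: le_supI1)
        qed
      qed
    qed
  qed
  from this[OF r(3)] show ?thesis
    using assms by simp
qed

lemma reach_sup:
  assumes "(a, b) \<in> reach p"
  shows "sup a z = sup b z \<or> (sup a z, sup b z) \<in> reach p"
proof -
  define w where "w = sup a z"
  have "a \<le> w" by (simp add: w_def)
  then have "\<forall>b. (a, b) \<in> reach p \<longrightarrow> w = sup b w \<or> (w, sup b w) \<in> reach p"
  proof (induction rule: cover_induct_down)
    case top
    then show ?case using covered_by_less[OF reach_cover] by (auto simp: sup_absorb1 less_imp_le)
  next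
    case (cover x c)
    show ?case
    proof (intro allI impI)
      fix b assume b: "(x, b) \<in> reach p"
      show "w = sup b w \<or> (w, sup b w) \<in> reach p"
      proof (cases "b = c")
        case True
        then show ?thesis using cover(2) by (simp add: sup_absorb2)
      next
        case False
        then have "(c, sup b c) \<in> reach p"
          using reach_up_cover[OF b] cover(1) by auto
        then have "w = sup (sup b c) w \<or> (w, sup (sup b c) w) \<in> reach p"
          using cover.IH by blast
        then show ?thesis
          using cover(2) by (simp add: sup_assoc sup_absorb2)
      qed
    qed
  qed
  then have "w = sup b w \<or> (w, sup b w) \<in> reach p"
    using assms by blast
  moreover have "sup b w = sup b z"
    using covered_by_less[OF reach_cover[OF assms]]
    by (simp add: w_def sup_assoc[symmetric] sup_absorb1 less_imp_le)
  ultimately show ?thesis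
    by (auto simp: w_def)
qed

lemma reach_chain_le: "(a, b) \<in> (reach p)\<^sup>* \<Longrightarrow> a \<le> b"
  by (induction rule: rtrancl_induct) (auto dest: reach_cover covered_by_less order_trans less_imp_le)

lemma reach_chain_sup:
  assumes "(a, b) \<in> (reach p)\<^sup>*"
  shows "(sup a z, sup b z) \<in> (reach p)\<^sup>*"
  using assms
proof (induction rule: rtrancl_induct)
  case (step b c)
  then show ?case
    using reach_sup[of b c p z] by (auto intro: rtrancl_into_rtrancl)
qed simp

text \<open>The step of the induction along a chain from \<open>inf a b\<close> to \<open>b\<close>. If \<open>c \<le> a\<close>, then \<open>[c, x]\<close> is
  down-perspective from \<open>[a, u]\<close>. Otherwise \<open>x \<le> sup c a\<close>, so joining \<open>c\<close> and \<open>x\<close> with the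
  members of a chain from \<open>inf a b\<close> to \<open>a\<close> eventually makes them equal. The interval \<open>[m, d]\<close>
  is the last proper one on this way; its top has three lower covers, namely \<open>m\<close>, one above the
  element \<open>y\<close> of the chain that made them equal, and one above \<open>x\<close>. Neither of the last two is the middle one.\<close>

lemma reach_meet_step:
  assumes ou: "(a, u) \<in> reach p" and cx: "covered_by c x" and x: "x \<le> b" and bu: "b \<le> u"
    and oc: "inf a b \<le> c" "(inf a b, c) \<in> (reach p)\<^sup>*"
  shows "(c, x) \<in> reach p"
proof (cases "c \<le> a")
  case True
  have "c \<le> b" "c \<le> x" "c \<noteq> x"
    using covered_by_less[OF cx] x by (auto intro: less_imp_le order_trans)
  have "\<not> x \<le> a"
  proof
    assume "x \<le> a"
    then have "x \<le> inf a b" using x by simp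
    then have "x \<le> c" using oc(1) by (rule order_trans)
    then show False using \<open>c \<le> x\<close> \<open>c \<noteq> x\<close> by auto
  qed
  then show ?thesis
    using reach_down[OF ou cx _ True] x bu by auto
next
  case False
  define o' where "o' = inf a b"
  have cb: "c \<le> b" "c \<le> x" "c \<noteq> x"
    using covered_by_less[OF cx] x by (auto intro: less_imp_le order_trans)
  have xa: "\<not> x \<le> a" using False cb by auto
  have au: "covered_by a u" by (rule reach_cover[OF ou])
  have "sup c a \<noteq> a" using False by (auto simp: le_iff_sup)
  then have "sup c a = u"
    using covered_by_between[OF au, of "sup c a"] cb bu covered_by_less[OF au]
    by (auto intro: less_imp_le order_trans)
  then have "x \<le> sup c a" using x bu by auto
  then have "finite {y. o' \<le> y \<and> y \<le> a \<and> x \<le> sup c y}" "a \<in> {y. o' \<le> y \<and> y \<le> a \<and> x \<le> sup c y}"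
    by (auto simp: o'_def)
  then obtain y where y: "o' \<le> y" "y \<le> a" "x \<le> sup c y"
    and ymin: "\<And>z. o' \<le> z \<Longrightarrow> z \<le> y \<Longrightarrow> x \<le> sup c z \<Longrightarrow> z = y"
    using finite_has_minimal2[of "{y. o' \<le> y \<and> y \<le> a \<and> x \<le> sup c y}" a]
    by simp (metis order_trans)
  have "y \<noteq> o'"
    using y(3) oc(1) cb by (auto simp: o'_def sup_absorb1)
  then obtain y' where y': "covered_by y' y" "o' \<le> y'"
    using y(1) cover_below_above[of o' y] by force
  have y'y: "y' < y" by (rule covered_by_less[OF y'(1)])
  then have xy': "\<not> x \<le> sup c y'"
    using ymin[of y'] y'(2) by (metis less_le)
  define m where "m = sup c y'"
  define d where "d = sup x y'"
  have md: "covered_by m d"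
    using cover_sup[OF cx, of y'] xy' by (simp add: m_def d_def)
  have d_eq: "d = sup c y"
  proof -
    have "\<not> y \<le> sup y' c"
      using xy' y(3) y'y by (metis le_sup_iff order.trans sup.commute sup.cobounded1)
    then have "covered_by (sup y' c) (sup y c)"
      using cover_sup[OF y'(1), of c] by simp
    then have "covered_by m (sup c y)"
      by (simp add: m_def sup_commute)
    moreover have "d \<le> sup c y"
      using y(3) y'y by (auto simp: d_def intro: le_supI2 less_imp_le)
    ultimately show ?thesis
      using covered_by_between[of m "sup c y" d] covered_by_less[OF md] by (auto simp: less_imp_le)
  qed
  \<comment> \<open>The links below \<open>c\<close>, pushed up by \<open>y\<close>, lead to \<open>d\<close>; the last of them is \<open>[a', d]\<close>.\<close>
  have "(sup o' y, sup c y) \<in> (reach p)\<^sup>*"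
    using reach_chain_sup[OF oc(2)] by (simp add: o'_def)
  then have "(y, d) \<in> (reach p)\<^sup>*"
    using y(1) by (simp add: d_eq sup_absorb2)
  moreover have "y \<noteq> d"
    using xa y(2) by (auto simp: d_def)
  ultimately obtain a' where a': "(y, a') \<in> (reach p)\<^sup>*" "(a', d) \<in> reach p"
    by (metis rtranclE)
  have ya': "y \<le> a'" and a'd: "covered_by a' d"
    using reach_chain_le[OF a'(1)] reach_cover[OF a'(2)] by auto
  have "\<not> y \<le> b"
  proof
    assume "y \<le> b"
    then have "y \<le> o'" using y(2) by (simp add: o'_def)
    then show False using y(1) \<open>y \<noteq> o'\<close> by simp
  qed
  then have "x \<noteq> d" using d_eq x by auto
  then have "x < d" by (simp add: d_def less_le)
  then obtain b' where b': "covered_by b' d" "x \<le> b'"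
    using cover_below_above by metis
  have nd: "\<not> d \<le> a'" "\<not> d \<le> b'" "\<not> d \<le> m"
    using a'd b' md covered_by_less less_le_not_le by blast+
  have "swings pos (a', d) (m, d)"
  proof (rule swingsI[OF a'd md b'(1)])
    have m: "c \<le> m" "y' \<le> m" by (simp_all add: m_def)
    show "a' \<noteq> m" using ya' nd d_eq m by auto
    show "m \<noteq> b'" using b' xy' by (auto simp: m_def)
    show "a' \<noteq> b'" using ya' b' nd d_eq cb by auto
    show "\<not> inf m b' \<le> a'"
    proof
      assume le: "inf m b' \<le> a'"
      have "c \<le> inf m b'"
        using m(1) order_trans[OF cb(2) b'(2)] by simp
      then have "c \<le> a'" using le by (rule order_trans)
      then show False using ya' nd(1) by (simp add: d_eq)
    qed
    show "\<not> inf m a' \<le> b'"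
    proof
      assume le: "inf m a' \<le> b'"
      have "y' \<le> inf m a'"
        using m(2) order_trans[OF less_imp_le[OF y'y] ya'] by simp
      then have "y' \<le> b'" using le by (rule order_trans)
      then show False using b'(2) nd(2) by (simp add: d_def)
    qed
  qed
  then have "(m, d) \<in> reach p"
    using reach_step[OF a'(2)] md by (simp add: step_def prime_interval_def)
  then show ?thesis
    using reach_down[of m d p c x] cx xy' by (simp add: m_def d_def)
qed

lemma reach_meet:
  assumes "(a, u) \<in> reach p" "b \<le> u"
  shows "(inf a b, b) \<in> (reach p)\<^sup>*"
proof -
  have "inf a b \<le> b" by simp
  then have "b \<le> b \<longrightarrow> (inf a b, b) \<in> (reach p)\<^sup>*"
  proof (induction "b" rule: cover_induct_up[where P = "\<lambda>x. x \<le> b \<longrightarrow> (inf a b, x) \<in> (reach p)\<^sup>*"])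
    case (cover c x)
    show ?case
    proof
      assume "x \<le> b"
      moreover have "c \<le> b"
        using calculation covered_by_less[OF cover(1)] by auto
      ultimately show "(inf a b, x) \<in> (reach p)\<^sup>*"
        using cover reach_meet_step[OF assms(1) cover(1) _ assms(2)]
        by (blast intro: rtrancl_into_rtrancl)
    qed
  qed simp
  then show ?thesis by simp
qed

section \<open>The congruence generated by the reachable prime intervals\<close>

text \<open>Taking the equivalence closure makes the congruence property a matter of single links; the price
  is that a zigzag between two elements may leave the interval they span, which
  \<open>prime_in_reach_cong\<close> repairs.\<close>

definition reach_cong :: "'a \<times> 'a \<Rightarrow> ('a \<times> 'a) set" where
  "reach_cong p = (reach p \<union> (reach p)\<inverse>)\<^sup>*"

lemma reach_cong_equiv: "equiv UNIV (reach_cong p)"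
proof -
  have "sym (reach_cong p)"
    unfolding reach_cong_def by (intro sym_rtrancl sym_Un_converse)
  then show ?thesis
    by (intro equivI) (auto simp: reach_cong_def refl_rtrancl trans_rtrancl)
qed

lemma reach_chain_cong: "(reach p)\<^sup>* \<subseteq> reach_cong p"
  unfolding reach_cong_def by (rule rtrancl_mono) simp

lemma reach_cong_translate:
  assumes "\<And>a b. (a, b) \<in> reach p \<Longrightarrow> (f a, f b) \<in> reach_cong p" and "(a, b) \<in> reach_cong p"
  shows "(f a, f b) \<in> reach_cong p"
  using assms(2) unfolding reach_cong_def
proof (induction rule: rtrancl_induct)
  case (step b c)
  have "(f b, f c) \<in> reach_cong p"
    using step.hyps(2) assms(1) equivE[OF reach_cong_equiv[of p]] by (metis Un_iff converseD symD)
  then show ?case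
    using step.IH unfolding reach_cong_def by (rule rtrancl_trans[rotated])
qed simp

lemma congruence_reach_cong: "congruence (reach_cong p)"
proof -
  have trans: "(a, c) \<in> reach_cong p" if "(a, b) \<in> reach_cong p" "(b, c) \<in> reach_cong p" for a b c
    using that unfolding reach_cong_def by (rule rtrancl_trans)
  have sup1: "(sup a z, sup b z) \<in> reach_cong p" if "(a, b) \<in> reach_cong p" for a b z
    using that
  proof (rule reach_cong_translate[where f = "\<lambda>a. sup a z", rotated])
    fix a b assume "(a, b) \<in> reach p"
    then show "(sup a z, sup b z) \<in> reach_cong p"
      using reach_sup[of a b p z] unfolding reach_cong_def by auto
  qed
  have inf1: "(inf a z, inf b z) \<in> reach_cong p" if "(a, b) \<in> reach_cong p" for a b z
    using that
  proof (rule reach_cong_translate[where f = "\<lambda>a. inf a z", rotated])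
    fix a b assume ab: "(a, b) \<in> reach p"
    then have "(inf a (inf b z), inf b z) \<in> (reach p)\<^sup>*"
      by (rule reach_meet) simp
    moreover have "inf a (inf b z) = inf a z"
      using covered_by_less[OF reach_cover[OF ab]] by (simp add: inf_assoc[symmetric] inf_absorb1 less_imp_le)
    ultimately show "(inf a z, inf b z) \<in> reach_cong p"
      using subsetD[OF reach_chain_cong[of p]] by simp
  qed
  show ?thesis
    unfolding congruence_def
  proof (intro conjI allI impI reach_cong_equiv)
    fix a b c d assume ab: "(a, b) \<in> reach_cong p" and cd: "(c, d) \<in> reach_cong p"
    show "(inf a c, inf b d) \<in> reach_cong p"
      using trans[OF inf1[OF ab, of c] inf1[OF cd, of b, unfolded inf_commute[of _ b]]] .
    show "(sup a c, sup b d) \<in> reach_cong p"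
      using trans[OF sup1[OF ab, of c] sup1[OF cd, of b, unfolded sup_commute[of _ b]]] .
  qed
qed

text \<open>Project the zigzag from \<open>a\<close> to \<open>b\<close> into \<open>[a, b]\<close> by \<open>z \<mapsto> inf (sup z a) b\<close>. As \<open>[a, b]\<close> is prime,
  some link jumps from \<open>a\<close> to \<open>b\<close>; that link must go upwards, and \<open>[a, b]\<close> is down-perspective from
  its join with \<open>a\<close>.\<close>

lemma prime_in_reach_cong:
  assumes "(a, b) \<in> reach_cong p" "covered_by a b"
  shows "(a, b) \<in> reach p"
proof -
  have "inf (sup z a) b = a \<or> (a, b) \<in> reach p" if "(a, z) \<in> reach_cong p" for z
    using that unfolding reach_cong_def
  proof (induction rule: rtrancl_induct)
    case base
    then show ?case using covered_by_less[OF assms(2)] by (simp add: inf_absorb1 less_imp_le)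
  next
    case (step z z')
    have between: "a \<le> inf (sup z' a) b"
      using covered_by_less[OF assms(2)] by (simp add: less_imp_le)
    show ?case
    proof (cases "inf (sup z a) b = a")
      case za: True
      consider "(z, z') \<in> reach p" | "(z', z) \<in> reach p" using step.hyps(2) by auto
      then show ?thesis
      proof cases
        case 1
        show ?thesis
        proof (cases "inf (sup z' a) b = a")
          case False
          then have "inf (sup z' a) b = b"
            using covered_by_between[OF assms(2) between inf_le2] by auto
          moreover from this za have "sup z a \<noteq> sup z' a"
            using covered_by_less[OF assms(2)] by auto
          ultimately have "(sup z a, sup z' a) \<in> reach p" "b \<le> sup z' a"
            using reach_sup[OF 1, of a] by (auto simp: inf.absorb_iff2)
          moreover have "\<not> b \<le> sup z a"
            using za covered_by_less[OF assms(2)] by (auto simp: inf_absorb2)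
          ultimately show ?thesis
            using reach_down assms(2) by (metis sup_ge2)
        qed simp
      next
        case 2
        then have "z' \<le> z" using covered_by_less[OF reach_cover] by (simp add: less_imp_le)
        then have "inf (sup z' a) b \<le> inf (sup z a) b"
          by (intro inf_mono sup_mono) auto
        then show ?thesis using za between by auto
      qed
    qed (use step.IH in simp)
  qed
  from this[OF assms(1)] show ?thesis
    using covered_by_less[OF assms(2)] by (auto simp: sup_absorb1 less_imp_le)
qed

lemma collapsed_imp_reach:
  assumes "prime_interval p" "prime_interval q" "collapses (con p) q"
  shows "q \<in> reach p"
proof -
  have "up_perspective p p"
    using covered_by_less[of "fst p" "snd p"] assms(1)
    by (simp add: up_perspective_def prime_interval_def inf_absorb2 sup_absorb1 less_imp_le)
  then have "p \<in> reach p"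
    using assms(1) unfolding reach_def by blast
  then have "collapses (reach_cong p) p"
    unfolding collapses_def reach_cong_def by auto
  then have "con p \<subseteq> reach_cong p"
    by (intro con_least congruence_reach_cong)
  then show ?thesis
    using assms(2,3) prime_in_reach_cong[of "fst q" "snd q" p]
    by (auto simp: collapses_def prime_interval_def)
qed

lemma swing_sequence_imp_collapsed:
  assumes "swing_sequence pos p q n r"
  shows "collapses (con p) q"
proof -
  have "collapses (con p) (r i)" if "i \<le> n" for i
    using that
  proof (induction i)
    case 0
    then show ?case
      using assms up_perspective_collapses[OF congruence_con[of p] _ collapses_con[of p], of "r 0"]
      by (simp add: swing_sequence_def)
  next
    case (Suc i)
    then have "down_perspective (r i) (r (Suc i)) \<or> swings pos (r i) (r (Suc i))"
      using assms by (auto simp: swing_sequence_def)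
    moreover have coll: "collapses (con p) (r i)"
      using Suc by simp
    ultimately show ?case
    proof (elim disjE)
      assume "down_perspective (r i) (r (Suc i))"
      then show ?thesis
        by (rule down_perspective_collapses[OF congruence_con _ coll])
    next
      assume "swings pos (r i) (r (Suc i))"
      then show ?thesis
        using swings_collapses[OF congruence_con, of "fst (r i)" "snd (r i)"
            "fst (r (Suc i))" "snd (r (Suc i))" p] coll
        by (simp add: collapses_def)
    qed
  qed
  then show ?thesis
    using assms by (auto simp: swing_sequence_def)
qed

end

section \<open>The Swing Lemma\<close>

text \<open>A path of minimal length has no repetitions, since a repetition could be cut out.\<close>

lemma rtranclp_distinct_path:
  assumes "R\<^sup>*\<^sup>* x y"
  shows "\<exists>n f. f 0 = x \<and> f n = y \<and> (\<forall>i<n. R (f i) (f (Suc i))) \<and> inj_on f {0..n}"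
proof -
  have ex: "\<exists>n. (R ^^ n) x y"
    using assms by (simp add: rtranclp_power)
  define n where "n = (LEAST n. (R ^^ n) x y)"
  have n: "(R ^^ n) x y" unfolding n_def by (rule LeastI_ex[OF ex])
  have least: "n \<le> k" if "(R ^^ k) x y" for k
    unfolding n_def using that by (rule Least_le)
  obtain f where f: "f 0 = x" "f n = y" "\<And>i. i < n \<Longrightarrow> R (f i) (f (Suc i))"
    using n by (auto simp: relpowp_fun_conv)
  have path: "(R ^^ k) (f i) (f (i + k))" if "i + k \<le> n" for i k
    using that
  proof (induction k)
    case (Suc k)
    then show ?case using f(3)[of "i + k"] by auto
  qed simp
  have "f i \<noteq> f j" if "i < j" "j \<le> n" for i j
  proof
    assume eq: "f i = f j"
    have "(R ^^ i) x (f i)" "(R ^^ (n - j)) (f j) y"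
      using path[of 0 i] path[of j "n - j"] that f(1,2) by simp_all
    then have "(R ^^ (i + (n - j))) x y"
      using eq by (auto simp: relpowp_add)
    then show False
      using least[of "i + (n - j)"] that by auto
  qed
  then have "inj_on f {0..n}"
    by (intro inj_onI) (metis atLeastAtMost_iff linorder_neqE_nat)
  with f show ?thesis by blast
qed

theorem lemma6:
  fixes pos :: "'a::{finite, lattice} \<Rightarrow> real \<times> real"
    and p q :: "'a \<times> 'a"
  assumes "sps_lattice pos"
    and "prime_interval p" and "prime_interval q" and "p \<noteq> q"
  shows "(collapses (con p) q \<longleftrightarrow> (\<exists>n r. swing_sequence pos p q n r)) \<and>
    (\<forall>n r. swing_sequence pos p q n r \<longrightarrow> (\<forall>i<n. snd (r i) \<ge> snd (r (Suc i))))"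
proof (intro conjI iffI allI impI)
  interpret sps_lattice pos by fact
  show "\<exists>n r. swing_sequence pos p q n r" if c: "collapses (con p) q"
  proof -
    obtain s where s: "prime_interval s" "up_perspective p s" "step\<^sup>*\<^sup>* s q"
      using collapsed_imp_reach[OF assms(2,3) c] unfolding reach_def by blast
    obtain n r where r: "r 0 = s" "r n = q" "\<forall>i<n. step (r i) (r (Suc i))"
        "inj_on r {0..n}"
      using rtranclp_distinct_path[OF s(3)] by (elim exE conjE)
    have "prime_interval (r i)" if "i \<le> n" for i
      using that s(1) r(1) r(3) by (cases i) (auto simp: step_def)
    then have "swing_sequence pos p q n r"
      using r s(2) unfolding swing_sequence_def step_def by auto
    then show ?thesis by blast
  qed
  show "collapses (con p) q" if "\<exists>n r. swing_sequence pos p q n r"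
    using that swing_sequence_imp_collapsed by blast
next
  fix n r i
  assume "swing_sequence pos p q n r" "i < n"
  then have "down_perspective (r i) (r (Suc i)) \<or> swings pos (r i) (r (Suc i))"
    by (simp add: swing_sequence_def)
  then show "snd (r (Suc i)) \<le> snd (r i)"
    by (auto simp: down_perspective_def swings_def)
qed

end
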